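(* Let $X$ be a separable topological space. Then $X$ satisfies $\mathsf{U}_{fin}(\mathcal{O},\mathcal{O})$ if and only if $X$ satisfies $\mathsf{U}_{fin}(\Delta,\mathcal{O})$.
   Context: No separation axiom is assumed. A cover always means a cover by open sets. $\mathcal{O}$ is the collection of all covers of $X$, and $\Delta$ is the collection of od-covers of $X$, i.e. covers all of whose members are (open and) dense in $X$. For collections $\mathcal{A},\mathcal{B}$ of covers of $X$, $X$ satisfies $\mathsf{U}_{fin}(\mathcal{A},\mathcal{B})$ if for each sequence $\langle\mathcal{U}_n : n\in\omega\rangle$ of members of $\mathcal{A}$, none of which has a finite subcover, there are finite $\mathcal{F}_n\subset\mathcal{U}_n$ such that $\{\bigcup\mathcal{F}_n : n\in\omega\}\in\mathcal{B}$. *)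

theory Defs
  imports "HOL-Analysis.Analysis"
begin

definition open_covers :: "'a topology \<Rightarrow> 'a set set set" where
  "open_covers X = {\<U>. (\<forall>U\<in>\<U>. openin X U) \<and> \<Union>\<U> = topspace X}"

definition od_covers :: "'a topology \<Rightarrow> 'a set set set" where
  "od_covers X = {\<U>. \<U> \<in> open_covers X \<and> (\<forall>U\<in>\<U>. X closure_of U = topspace X)}"

text \<open>The space \<open>X\<close> is an argument of its own because the requirement that no member of the
  sequence has a finite subcover refers to all finite subfamilies that cover \<open>X\<close>, whatever the
  collections \<open>\<A>\<close> and \<open>\<B>\<close> are. The families \<open>\<F> n\<close> may be empty, and the resulting family of
  unions is a set, so repetitions are not counted.\<close>

definition U_fin :: "'a topology \<Rightarrow> 'a set set set \<Rightarrow> 'a set set set \<Rightarrow> bool" where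
  "U_fin X \<A> \<B> \<longleftrightarrow>
     (\<forall>\<U> :: nat \<Rightarrow> 'a set set.
        (\<forall>n. \<U> n \<in> \<A> \<and> \<not> (\<exists>\<V>. finite \<V> \<and> \<V> \<subseteq> \<U> n \<and> \<V> \<in> open_covers X)) \<longrightarrow>
        (\<exists>\<F> :: nat \<Rightarrow> 'a set set.
           (\<forall>n. finite (\<F> n) \<and> \<F> n \<subseteq> \<U> n) \<and> range (\<lambda>n. \<Union>(\<F> n)) \<in> \<B>))"

end

theory Submission
  imports Defs
begin

text \<open>Let \<open>D = {d 0, d 1, \<dots>}\<close> be dense and let \<open>\<U> n\<close> be open covers. Choose \<open>W n \<in> \<U> n\<close> with
  \<open>d n \<in> W n\<close>. Then \<open>O = \<Union>n. W n\<close> is dense and open, so \<open>{U \<union> O | U \<in> \<U> n}\<close> is an od-cover.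
  Finite selections from these od-covers that cover the space become finite selections from the
  \<open>\<U> n\<close> by dropping \<open>O\<close> and adding \<open>W n\<close> to the \<open>n\<close>-th one. If one of the od-covers has a finite
  subcover, the same conversion works with that subcover alone.\<close>

lemma od_covers_subset_open_covers: "od_covers X \<subseteq> open_covers X"
  by (auto simp: od_covers_def)

lemma U_fin_antimono: "\<A>' \<subseteq> \<A> \<Longrightarrow> U_fin X \<A> \<B> \<Longrightarrow> U_fin X \<A>' \<B>"
  unfolding U_fin_def by (meson subsetD)

lemma range_Union_in_open_covers:
  assumes "\<And>n. \<U> n \<in> open_covers X" "\<And>n. \<F> n \<subseteq> \<U> n" "topspace X \<subseteq> (\<Union>n. \<Union>(\<F> n))"
  shows "range (\<lambda>n. \<Union>(\<F> n)) \<in> open_covers X"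
proof -
  have op: "openin X (\<Union>(\<F> n))" for n
    using assms(1)[of n] assms(2)[of n] by (auto simp: open_covers_def)
  then have "(\<Union>n. \<Union>(\<F> n)) \<subseteq> topspace X"
    using openin_subset by blast
  with op assms(3) show ?thesis
    unfolding open_covers_def by auto
qed

text \<open>Each new member contains the dense set \<open>W\<close>, hence is dense. Openness of
  \<open>W\<close> keeps it inside \<open>topspace X\<close>, so the enlarged sets still have union
  \<open>topspace X\<close>.\<close>

lemma od_cover_by_Un_dense:
  assumes "\<U> \<in> open_covers X" "\<U> \<noteq> {}" "openin X W" "X closure_of W = topspace X"
  shows "(\<lambda>U. U \<union> W) ` \<U> \<in> od_covers X"
  using assms openin_subset[OF assms(3)]
  by (auto simp: od_covers_def open_covers_def closure_of_Un openin_Un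
      intro: closure_of_subset_topspace[THEN subsetD])

text \<open>A nonempty space has a nonempty dense set \<open>D\<close>, so a countable one can be
  written as \<open>range d\<close> with all naturals as indices, possibly with repetitions. The
  sets \<open>W n\<close> chosen around the points \<open>d n\<close> then cover
  \<open>D\<close>.\<close>

lemma dense_Union_selection:
  assumes "separable_space X" "topspace X \<noteq> {}" "\<And>n::nat. \<U> n \<in> open_covers X"
  obtains W where "\<And>n. W n \<in> \<U> n" "X closure_of (\<Union>n. W n) = topspace X"
proof -
  obtain D where D: "countable D" "D \<subseteq> topspace X" "X closure_of D = topspace X"
    using assms(1) by (auto simp: separable_space_def)
  then have "D \<noteq> {}"
    using assms(2) by (metis closure_of_empty)
  then obtain d :: "nat \<Rightarrow> 'a" where d: "D = range d"
    using D(1) uncountable_def by blast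
  have "\<exists>U\<in>\<U> n. d n \<in> U" for n
  proof -
    have "d n \<in> \<Union>(\<U> n)"
      using assms(3)[of n] D(2) d by (simp add: open_covers_def image_subset_iff)
    then show ?thesis
      by blast
  qed
  then obtain W where W: "\<And>n. W n \<in> \<U> n" "\<And>n. d n \<in> W n"
    by metis
  have "X closure_of D \<subseteq> X closure_of (\<Union>n. W n)"
    using W(2) d by (intro closure_of_mono) auto
  with D(3) closure_of_subset_topspace[of X "\<Union>n. W n"] W(1) that show thesis
    by auto
qed

theorem proposition3p7:
  fixes X :: "'a topology"
  assumes "separable_space X"
  shows "U_fin X (open_covers X) (open_covers X) \<longleftrightarrow> U_fin X (od_covers X) (open_covers X)"
proof
  assume "U_fin X (open_covers X) (open_covers X)"
  then show "U_fin X (od_covers X) (open_covers X)"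
    by (rule U_fin_antimono[OF od_covers_subset_open_covers])
next
  assume od: "U_fin X (od_covers X) (open_covers X)"
  show "U_fin X (open_covers X) (open_covers X)"
    unfolding U_fin_def
  proof (intro allI impI)
    fix \<U> :: "nat \<Rightarrow> 'a set set"
    assume "\<forall>n. \<U> n \<in> open_covers X \<and> \<not> (\<exists>\<V>. finite \<V> \<and> \<V> \<subseteq> \<U> n \<and> \<V> \<in> open_covers X)"
    then have cov: "\<And>n. \<U> n \<in> open_covers X"
      and nofin: "\<And>n \<V>. finite \<V> \<Longrightarrow> \<V> \<subseteq> \<U> n \<Longrightarrow> \<V> \<notin> open_covers X"
      by auto
    have ne: "\<U> n \<noteq> {}" for n
      using nofin[of "{}" n] cov[of n] by auto
    \<comment> \<open>In an empty space the empty subfamily would already be a finite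
      subcover.\<close>
    have "topspace X \<noteq> {}"
      using nofin[of "{}" 0] by (auto simp: open_covers_def)
    then obtain W where W: "\<And>n. W n \<in> \<U> n" "X closure_of (\<Union>n. W n) = topspace X"
      using dense_Union_selection[of X \<U>] assms cov by blast
    define Z where "Z = (\<Union>n. W n)"
    have "openin X (W n)" for n
      using W(1) cov[of n] by (auto simp: open_covers_def)
    then have "openin X Z"
      by (auto simp: Z_def)
    define \<V> where "\<V> n = (\<lambda>U. U \<union> Z) ` \<U> n" for n
    have \<V>: "\<V> n \<in> od_covers X" for n
      unfolding \<V>_def using od_cover_by_Un_dense[OF cov ne \<open>openin X Z\<close>] W(2)
      by (simp add: Z_def)
    \<comment> \<open>The hypothesis \<open>od\<close> speaks only of sequences without finite
      subcovers, and enlarging the members by \<open>Z\<close> may have created one; hence the case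
      split.\<close>
    have "\<exists>\<G>. (\<forall>n. finite (\<G> n) \<and> \<G> n \<subseteq> \<V> n) \<and> topspace X \<subseteq> (\<Union>n. \<Union>(\<G> n))"
    proof (cases "\<exists>n \<H>. finite \<H> \<and> \<H> \<subseteq> \<V> n \<and> \<H> \<in> open_covers X")
      case True
      then obtain m \<H> where \<H>: "finite \<H>" "\<H> \<subseteq> \<V> m" "\<H> \<in> open_covers X"
        by blast
      then have "topspace X \<subseteq> \<Union>\<H>"
        by (simp add: open_covers_def)
      also have "\<Union>\<H> = (\<Union>n. \<Union>(if n = m then \<H> else {}))"
        by (auto split: if_splits)
      finally have "topspace X \<subseteq> (\<Union>n. \<Union>(if n = m then \<H> else {}))" .
      with \<H>(1,2) show ?thesis
        \<comment> \<open>One finite subcover, placed at index \<open>m\<close>, covers the space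
          alone; all other selections are empty.\<close>
        by (intro exI[of _ "\<lambda>n. if n = m then \<H> else {}"]) simp
    next
      case False
      then obtain \<G> where \<G>: "\<And>n. finite (\<G> n) \<and> \<G> n \<subseteq> \<V> n"
          "range (\<lambda>n. \<Union>(\<G> n)) \<in> open_covers X"
        using od \<V> unfolding U_fin_def by meson
      then show ?thesis
        by (intro exI[of _ \<G>]) (auto simp: open_covers_def)
    qed
    then obtain \<G> where \<G>: "\<And>n. finite (\<G> n)" "\<And>n. \<G> n \<subseteq> \<V> n" "topspace X \<subseteq> (\<Union>n. \<Union>(\<G> n))"
      by blast
    \<comment> \<open>Adding \<open>Z\<close> need not be injective, so one preimage is picked for
      each of the finitely many members of \<open>\<G> n\<close>.\<close>
    have "\<exists>\<F>. \<F> \<subseteq> \<U> n \<and> finite \<F> \<and> \<G> n = (\<lambda>U. U \<union> Z) ` \<F>" for n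
      using finite_subset_image[OF \<G>(1)[of n]] \<G>(2)[of n] unfolding \<V>_def by blast
    then obtain \<F> where \<F>: "\<And>n. \<F> n \<subseteq> \<U> n" "\<And>n. finite (\<F> n)"
        "\<And>n. \<G> n = (\<lambda>U. U \<union> Z) ` \<F> n"
      by metis
    have "topspace X \<subseteq> (\<Union>n. \<Union>(insert (W n) (\<F> n)))"
    proof
      fix x assume "x \<in> topspace X"
      then obtain n G where "G \<in> \<G> n" "x \<in> G"
        using \<G>(3) by blast
      \<comment> \<open>Here \<open>G\<close> is \<open>U \<union> Z\<close> with \<open>U\<close>
        in \<open>\<F> n\<close>. If \<open>x\<close> lies in \<open>Z\<close>, it is covered by
        some \<open>W k\<close>, inserted at index \<open>k\<close>, which may differ from
        \<open>n\<close>.\<close>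
      then show "x \<in> (\<Union>n. \<Union>(insert (W n) (\<F> n)))"
        unfolding \<F>(3) Z_def by blast
    qed
    moreover have sub: "insert (W n) (\<F> n) \<subseteq> \<U> n" for n
      using W(1) \<F>(1) by auto
    ultimately have "range (\<lambda>n. \<Union>(insert (W n) (\<F> n))) \<in> open_covers X"
      by (intro range_Union_in_open_covers[of \<U>] cov)
    with \<F>(2) sub
    show "\<exists>\<F>. (\<forall>n. finite (\<F> n) \<and> \<F> n \<subseteq> \<U> n) \<and> range (\<lambda>n. \<Union>(\<F> n)) \<in> open_covers X"
      by (intro exI[of _ "\<lambda>n. insert (W n) (\<F> n)"]) auto
  qed
qed

end
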